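(* Let $s,t\geq 2$ and let $\Gamma$ be the point graph of a finite generalized quadrangle of order $(s,t)$ that has at least one regular pair $(x,y)$ of points. Then the complement $\overline{\Gamma}$ (a connected strongly regular graph) is a counterexample to Brouwer's Conjecture: if $(v,k,\lambda,\mu)$ are the strongly regular graph parameters of $\overline{\Gamma}$, there is a disconnecting set $S$ of $\overline{\Gamma}$ such that every component of $\overline{\Gamma}\setminus S$ has at least two vertices and $|S|<2k-\lambda-2$.
   Context: All graphs are finite and simple. A graph $G$ is a $(v,k,\lambda,\mu)$-SRG (strongly regular graph) if it has $v$ vertices, is $k$-regular, any two adjacent vertices have exactly $\lambda$ common neighbors, and any two distinct non-adjacent vertices have exactly $\mu$ common neighbors. A disconnecting set of a connected graph $G$ is a set $S$ of vertices such that $G\setminus S$ is disconnected. Brouwer's Conjecture asserts that if $G$ is a connected $(v,k,\lambda,\mu)$-SRG and $S$ is a disconnecting set whose removal disconnects $G$ into non-singleton components, then $|S|\geq 2k-\lambda-2$. A generalized quadrangle of order $(s,t)$ is a pair $(P,L)$ with $L\subseteq 2^P$ (points and lines) such that any two distinct points lie on at most one common line, every line contains exactly $s+1$ points, every point is on exactly $t+1$ lines, and for every point $p$ and line $\ell$ with $p\notin \ell$, $p$ is collinear with exactly one point of $\ell$. Two distinct points are collinear if some line contains both. The point graph $\Gamma$ has vertex set $P$, with two distinct points adjacent when collinear. For a vertex $x$ put $x^{\perp}=\{x\}\cup\Gamma(x)$, where $\Gamma(x)$ is the set of neighbors of $x$ in $\Gamma$, and for a set $A$ of vertices put $A^{\perp}=\bigcap_{a\in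 A}a^{\perp}$. A pair $(x,y)$ of distinct non-adjacent vertices of $\Gamma$ is regular if the hyperbolic line $\{x,y\}^{\perp\perp}$ has size $t+1$. *)

theory Defs
  imports "Graph_Theory.Digraph_Component" "Graph_Theory.Pair_Digraph"
begin

text \<open>
  A finite simple graph is a \<open>pair_graph\<close>: a finite, symmetric, loop-free digraph whose arcs are
  pairs of vertices, so that every edge is represented by its two orientations. For such a graph
  the strongly connected components are the components in the usual sense.
\<close>

definition neighbours :: "'a pair_pre_digraph \<Rightarrow> 'a \<Rightarrow> 'a set" where
  "neighbours G x = {y \<in> pverts G. (x, y) \<in> parcs G}"

definition graph_complement :: "'a pair_pre_digraph \<Rightarrow> 'a pair_pre_digraph" where
  "graph_complement G =
    \<lparr> pverts = pverts G,
      parcs = {(x, y). x \<in> pverts G \<and> y \<in> pverts G \<and> x \<noteq> y \<and> (x, y) \<notin> parcs G} \<rparr>"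

locale strongly_regular_graph = pair_graph G
  for G :: "'a pair_pre_digraph" and v k l m :: nat +
  assumes card_vertices: "card (pverts G) = v"
    and regular: "x \<in> pverts G \<Longrightarrow> card (neighbours G x) = k"
    and common_neighbours_adjacent:
      "\<lbrakk>x \<in> pverts G; y \<in> pverts G; (x, y) \<in> parcs G\<rbrakk>
        \<Longrightarrow> card (neighbours G x \<inter> neighbours G y) = l"
    and common_neighbours_nonadjacent:
      "\<lbrakk>x \<in> pverts G; y \<in> pverts G; x \<noteq> y; (x, y) \<notin> parcs G\<rbrakk>
        \<Longrightarrow> card (neighbours G x \<inter> neighbours G y) = m"

definition remove_vertices :: "'a pair_pre_digraph \<Rightarrow> 'a set \<Rightarrow> ('a, 'a \<times> 'a) pre_digraph" where
  "remove_vertices G S = with_proj G \<restriction> (pverts G - S)"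

text \<open>
  The library's \<open>connected\<close> fails for the graph without vertices; removing all vertices
  does not count as disconnecting a graph, hence the nonemptiness condition.
\<close>

definition disconnecting_set :: "'a pair_pre_digraph \<Rightarrow> 'a set \<Rightarrow> bool" where
  "disconnecting_set G S \<longleftrightarrow>
    S \<subseteq> pverts G \<and> pverts G - S \<noteq> {} \<and> \<not> connected (remove_vertices G S)"

definition collinear :: "'a set set \<Rightarrow> 'a \<Rightarrow> 'a \<Rightarrow> bool" where
  "collinear L p q \<longleftrightarrow> p \<noteq> q \<and> (\<exists>l\<in>L. p \<in> l \<and> q \<in> l)"

locale generalized_quadrangle =
  fixes P :: "'a set" and L :: "'a set set" and s t :: nat
  assumes lines_subset: "L \<subseteq> Pow P"
    and unique_line:
      "\<lbrakk>p \<in> P; q \<in> P; p \<noteq> q; l \<in> L; l' \<in> L; p \<in> l; q \<in> l; p \<in> l'; q \<in> l'\<rbrakk> \<Longrightarrow> l = l'"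
    and card_line: "l \<in> L \<Longrightarrow> card l = s + 1"
    and card_lines_through: "p \<in> P \<Longrightarrow> card {l \<in> L. p \<in> l} = t + 1"
    and unique_collinear: "\<lbrakk>p \<in> P; l \<in> L; p \<notin> l\<rbrakk> \<Longrightarrow> \<exists>!q. q \<in> l \<and> collinear L p q"

definition point_graph :: "'a set \<Rightarrow> 'a set set \<Rightarrow> 'a pair_pre_digraph" where
  "point_graph P L =
    \<lparr> pverts = P, parcs = {(x, y). x \<in> P \<and> y \<in> P \<and> collinear L x y} \<rparr>"

definition perp :: "'a pair_pre_digraph \<Rightarrow> 'a set \<Rightarrow> 'a set" where
  "perp G A = {z \<in> pverts G. \<forall>a\<in>A. z \<in> insert a (neighbours G a)}"

definition regular_pair :: "'a pair_pre_digraph \<Rightarrow> nat \<Rightarrow> 'a \<Rightarrow> 'a \<Rightarrow> bool" where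
  "regular_pair G t x y \<longleftrightarrow>
    x \<in> pverts G \<and> y \<in> pverts G \<and> x \<noteq> y \<and> (x, y) \<notin> parcs G \<and>
    card (perp G (perp G {x, y})) = t + 1"

end

theory Submission
  imports Defs
begin

text \<open>
  Let \<open>A = {x, y}\<^sup>\<perp>\<close> and \<open>B = {x, y}\<^sup>\<perp>\<^sup>\<perp>\<close> for a regular pair \<open>(x, y)\<close>. Both are cocliques of \<open>\<Gamma>\<close> of
  size \<open>t + 1\<close>, and every point of \<open>A\<close> is collinear with every point of \<open>B\<close>. In the complement,
  \<open>A\<close> and \<open>B\<close> are therefore disjoint cliques without edges between them, so removing all other
  points leaves exactly the components \<open>A\<close> and \<open>B\<close>. If \<open>\<Gamma>\<close> has \<open>v\<close> vertices, this removes
  \<open>v - 2t - 2\<close> of them, while \<open>2k - \<lambda> - 2\<close> equals \<open>v - t - 3\<close> for the complement, whatever the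
  valency of \<open>\<Gamma>\<close> is.
\<close>

section \<open>Complements of strongly regular graphs\<close>

lemma graph_complement_simps [simp]:
  "pverts (graph_complement G) = pverts G"
  "(x, y) \<in> parcs (graph_complement G) \<longleftrightarrow>
    x \<in> pverts G \<and> y \<in> pverts G \<and> x \<noteq> y \<and> (x, y) \<notin> parcs G"
  by (auto simp: graph_complement_def)

lemma neighbours_subset: "neighbours G x \<subseteq> pverts G"
  by (auto simp: neighbours_def)

lemma pair_graph_graph_complement:
  assumes "pair_graph G"
  shows "pair_graph (graph_complement G)"
proof -
  interpret pair_graph G by fact
  have arcs: "parcs (graph_complement G) \<subseteq> pverts G \<times> pverts G" by auto
  show ?thesis
  proof
    show "finite (parcs (graph_complement G))"
      using arcs pair_finite_verts by (meson finite_SigmaI finite_subset)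
    show "symmetric (with_proj (graph_complement G))"
      using pair_sym_arcs by (auto simp: symmetric_def sym_def)
  qed (use arcs pair_finite_verts in \<open>auto simp: graph_complement_def\<close>)
qed

context strongly_regular_graph
begin

lemma finite_neighbours: "finite (neighbours G x)"
  using neighbours_subset pair_finite_verts by (rule finite_subset)

lemma adjacent_sym: "(x, y) \<in> parcs G \<Longrightarrow> (y, x) \<in> parcs G"
  using pair_sym_arcs by (auto simp: symmetric_def sym_def)

text \<open>The neighbours in \<Gamma>, the neighbours in the complement and \<open>x\<close> itself
  partition the vertices. Like the following counts, this is kept as a sum, so that no truncated
  subtraction on \<open>nat\<close> gets in the way of the later arithmetic.\<close>

lemma card_neighbours_complement:
  assumes "x \<in> pverts G"
  shows "card (neighbours (graph_complement G) x) + k + 1 = v"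
proof -
  let ?N = "neighbours G x" and ?M = "neighbours (graph_complement G) x"
  have "pverts G = insert x (?N \<union> ?M)" "x \<notin> ?N \<union> ?M" "?N \<inter> ?M = {}"
    using assms pair_no_loops[of "(x, x)"] by (auto simp: neighbours_def)
  moreover have "finite ?M"
    using neighbours_subset[of "graph_complement G" x] pair_finite_verts
    by (auto intro: finite_subset)
  ultimately show ?thesis
    using card_vertices regular[OF assms] finite_neighbours
    by (simp add: card_Un_disjoint)
qed

lemma card_Un_neighbours:
  assumes "x \<in> pverts G" "y \<in> pverts G"
  shows "card (neighbours G x \<union> neighbours G y) + card (neighbours G x \<inter> neighbours G y) = 2 * k"
  using card_Un_Int[OF finite_neighbours finite_neighbours, of x y] regular assms by simp

text \<open>A common neighbour in the complement is a vertex outside both neighbourhoods and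
  different from \<open>x\<close> and \<open>y\<close>. The pair \<open>{x, y}\<close> is kept apart
  in the union because it is disjoint from the neighbourhoods when \<open>x\<close> and
  \<open>y\<close> are distinct and non-adjacent, but absorbed by them when they are adjacent. Hence
  the extra 2 in only one of the next two lemmas.\<close>

lemma card_common_neighbours_complement:
  assumes "x \<in> pverts G" "y \<in> pverts G"
  shows "card (neighbours (graph_complement G) x \<inter> neighbours (graph_complement G) y)
    + card ({x, y} \<union> (neighbours G x \<union> neighbours G y)) = v"
proof -
  let ?U = "{x, y} \<union> (neighbours G x \<union> neighbours G y)"
  have "neighbours (graph_complement G) x \<inter> neighbours (graph_complement G) y = pverts G - ?U"
    using assms by (auto simp: neighbours_def)
  moreover have "?U \<subseteq> pverts G"
    using assms by (auto simp: neighbours_def)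
  then have "card (pverts G - ?U) + card ?U = v"
    using card_vertices pair_finite_verts card_mono[of "pverts G" ?U]
      card_Diff_subset[of ?U "pverts G"] finite_subset[of ?U "pverts G"]
    by (metis le_add_diff_inverse2)
  ultimately show ?thesis
    by metis
qed

lemma card_common_neighbours_complement_nonadjacent:
  assumes "x \<in> pverts G" "y \<in> pverts G" "x \<noteq> y" "(x, y) \<notin> parcs G"
  shows "card (neighbours (graph_complement G) x \<inter> neighbours (graph_complement G) y)
    + 2 * k + 2 = v + m"
proof -
  have "{x, y} \<inter> (neighbours G x \<union> neighbours G y) = {}"
    using assms pair_no_loops adjacent_sym by (fastforce simp: neighbours_def)
  then have "card ({x, y} \<union> (neighbours G x \<union> neighbours G y))
      = 2 + card (neighbours G x \<union> neighbours G y)"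
    using assms(3) finite_neighbours by (subst card_Un_disjoint) auto
  then show ?thesis
    using card_common_neighbours_complement[of x y] card_Un_neighbours[of x y]
      common_neighbours_nonadjacent[of x y] assms by simp
qed

lemma card_common_neighbours_complement_adjacent:
  assumes "x \<in> pverts G" "y \<in> pverts G" "(x, y) \<in> parcs G"
  shows "card (neighbours (graph_complement G) x \<inter> neighbours (graph_complement G) y)
    + 2 * k = v + l"
proof -
  have "{x, y} \<union> (neighbours G x \<union> neighbours G y) = neighbours G x \<union> neighbours G y"
    using assms adjacent_sym by (auto simp: neighbours_def)
  then show ?thesis
    using card_common_neighbours_complement[of x y] card_Un_neighbours[of x y]
      common_neighbours_adjacent[of x y] assms by simp
qed

text \<open>Complementation exchanges adjacent and non-adjacent pairs, so \<open>m\<close> goes into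
  the third parameter and \<open>l\<close> into the fourth.\<close>

theorem strongly_regular_graph_complement:
  "strongly_regular_graph (graph_complement G) v (v - (k + 1)) (v + m - (2 * k + 2)) (v + l - 2 * k)"
proof -
  interpret C: pair_graph "graph_complement G"
    by (rule pair_graph_graph_complement) unfold_locales
  show ?thesis
  proof
    show "card (pverts (graph_complement G)) = v"
      using card_vertices by simp
  next
    fix x assume "x \<in> pverts (graph_complement G)"
    then show "card (neighbours (graph_complement G) x) = v - (k + 1)"
      using card_neighbours_complement[of x] by simp
  next
    fix x y assume "(x, y) \<in> parcs (graph_complement G)"
    then show "card (neighbours (graph_complement G) x \<inter> neighbours (graph_complement G) y)
        = v + m - (2 * k + 2)"
      using card_common_neighbours_complement_nonadjacent[of x y] by simp
  next
    fix x y
    assume "x \<in> pverts (graph_complement G)" "y \<in> pverts (graph_complement G)" "x \<noteq> y"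
      "(x, y) \<notin> parcs (graph_complement G)"
    then show "card (neighbours (graph_complement G) x \<inter> neighbours (graph_complement G) y)
        = v + l - 2 * k"
      using card_common_neighbours_complement_adjacent[of x y] by simp
  qed
qed

end

section \<open>The point graph of a generalized quadrangle is strongly regular\<close>

lemma collinear_sym: "collinear L p q \<Longrightarrow> collinear L q p"
  by (auto simp: collinear_def)

lemma point_graph_simps [simp]:
  "pverts (point_graph P L) = P"
  "(x, y) \<in> parcs (point_graph P L) \<longleftrightarrow> x \<in> P \<and> y \<in> P \<and> collinear L x y"
  by (auto simp: point_graph_def)

lemma neighbours_point_graph:
  "neighbours (point_graph P L) p = {q \<in> P. p \<in> P \<and> collinear L p q}"
  by (auto simp: neighbours_def)

context generalized_quadrangle
begin

lemma line_points: "l \<in> L \<Longrightarrow> p \<in> l \<Longrightarrow> p \<in> P"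
  using lines_subset by auto

lemma finite_line: "l \<in> L \<Longrightarrow> finite l"
  using card_line by (metis Suc_eq_plus1 card.infinite nat.distinct(1))

lemma finite_lines_through: "p \<in> P \<Longrightarrow> finite {l \<in> L. p \<in> l}"
  using card_lines_through by (metis Suc_eq_plus1 card.infinite nat.distinct(1))

lemma collinearI: "l \<in> L \<Longrightarrow> p \<in> l \<Longrightarrow> q \<in> l \<Longrightarrow> p \<noteq> q \<Longrightarrow> collinear L p q"
  by (auto simp: collinear_def)

text \<open>Off the line, \<open>z\<close> would be collinear with only one of its points. So a
  generalized quadrangle has no triangles other than those inside a line.\<close>

lemma collinear_with_two_on_line:
  assumes "z \<in> P" "l \<in> L" "p \<in> l" "q \<in> l" "p \<noteq> q" "collinear L z p" "collinear L z q"
  shows "z \<in> l"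
  using unique_collinear assms by blast

text \<open>Both \<open>a\<close> and \<open>b\<close> are forced onto the line through
  \<open>p\<close> and \<open>q\<close>. Used in contrapositive form: the common neighbours of two
  distinct non-collinear points form a coclique.\<close>

lemma collinear_if_common_neighbours:
  assumes "a \<in> P" "b \<in> P" "a \<noteq> b" "p \<in> P" "q \<in> P" "collinear L p q"
    and "collinear L a p" "collinear L a q" "collinear L b p" "collinear L b q"
  shows "collinear L a b"
proof -
  obtain l where "l \<in> L" "p \<in> l" "q \<in> l" "p \<noteq> q"
    using \<open>collinear L p q\<close> by (auto simp: collinear_def)
  then show ?thesis
    using assms collinear_with_two_on_line collinearI by metis
qed

lemma pair_graph_point_graph:
  assumes "finite P"
  shows "pair_graph (point_graph P L)"
proof
  have "parcs (point_graph P L) \<subseteq> P \<times> P" by auto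
  then show "finite (parcs (point_graph P L))"
    using assms by (meson finite_SigmaI finite_subset)
  show "symmetric (with_proj (point_graph P L))"
    by (auto simp: symmetric_def sym_def intro: collinear_sym)
qed (use assms in \<open>auto simp: point_graph_def collinear_def\<close>)

lemma card_collinear:
  assumes "p \<in> P"
  shows "card {q \<in> P. collinear L p q} = (t + 1) * s"
proof -
  \<comment> \<open>The \<open>t + 1\<close> lines through \<open>p\<close> meet only in
    \<open>p\<close>, so they split its neighbours into classes of size \<open>s\<close>.\<close>
  have "{q \<in> P. collinear L p q} = (\<Union>l\<in>{l \<in> L. p \<in> l}. l - {p})"
    using line_points by (auto simp: collinear_def)
  also have "card \<dots> = (\<Sum>l\<in>{l \<in> L. p \<in> l}. card (l - {p}))"
    using finite_lines_through[OF assms] finite_line unique_line[OF assms] line_points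
    by (intro card_UN_disjoint) blast+
  also have "\<dots> = (\<Sum>l\<in>{l \<in> L. p \<in> l}. s)"
    by (rule sum.cong) (auto simp: card_line)
  finally show ?thesis
    using card_lines_through[OF assms] by simp
qed

lemma card_common_collinear:
  assumes "p \<in> P" "q \<in> P" "collinear L p q"
  shows "card {z \<in> P. collinear L p z \<and> collinear L q z} = s - 1"
proof -
  obtain l where l: "l \<in> L" "p \<in> l" "q \<in> l" "p \<noteq> q"
    using assms by (auto simp: collinear_def)
  have "{z \<in> P. collinear L p z \<and> collinear L q z} = l - {p, q}"
  proof (intro equalityI subsetI)
    fix z assume "z \<in> {z \<in> P. collinear L p z \<and> collinear L q z}"
    then show "z \<in> l - {p, q}"
      using collinear_with_two_on_line[OF _ l, of z] collinear_sym[of L _ z]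
      by (auto simp: collinear_def)
  next
    fix z assume "z \<in> l - {p, q}"
    then show "z \<in> {z \<in> P. collinear L p z \<and> collinear L q z}"
      using l line_points collinearI by auto
  qed
  then show ?thesis
    using l card_line by (simp add: card_Diff_subset)
qed

text \<open>Each line through \<open>p\<close> carries exactly one point collinear with \<open>q\<close>.\<close>

lemma card_common_noncollinear:
  assumes "p \<in> P" "q \<in> P" "p \<noteq> q" "\<not> collinear L p q"
  shows "card {z \<in> P. collinear L p z \<and> collinear L q z} = t + 1"
proof -
  let ?Z = "{z \<in> P. collinear L p z \<and> collinear L q z}"
  let ?f = "\<lambda>l. THE z. z \<in> l \<and> collinear L q z"
  have foot: "?f l \<in> l \<and> collinear L q (?f l)" and foot_eq: "z \<in> l \<Longrightarrow> collinear L q z \<Longrightarrow> ?f l = z"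
    if "l \<in> L" "p \<in> l" for l z
  proof -
    have "q \<notin> l"
      using that assms collinearI by blast
    then have ex1: "\<exists>!z. z \<in> l \<and> collinear L q z"
      using unique_collinear that assms by blast
    show "?f l \<in> l \<and> collinear L q (?f l)"
      using theI'[OF ex1] .
    show "?f l = z" if "z \<in> l" "collinear L q z"
      using ex1 that by (intro the1_equality) auto
  qed
  \<comment> \<open>This yields injectivity: two lines through \<open>p\<close> with the same foot
    would share the two distinct points \<open>p\<close> and that foot.\<close>
  have foot_neq: "?f l \<noteq> p" if "l \<in> L" "p \<in> l" for l
    using foot[OF that] assms(4) collinear_sym by metis
  have "bij_betw ?f {l \<in> L. p \<in> l} ?Z"
  proof (rule bij_betwI')
    fix l l' assume "l \<in> {l \<in> L. p \<in> l}" "l' \<in> {l \<in> L. p \<in> l}"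
    then show "(?f l = ?f l') = (l = l')"
      using foot[of l] foot[of l'] foot_neq[of l] unique_line[of p "?f l" l l'] assms(1) line_points
      by auto
  next
    fix l assume "l \<in> {l \<in> L. p \<in> l}"
    then show "?f l \<in> ?Z"
      using foot[of l] foot_neq[of l] line_points collinearI by auto
  next
    fix z assume z: "z \<in> ?Z"
    then obtain l where "l \<in> L" "p \<in> l" "z \<in> l"
      by (auto simp: collinear_def)
    then show "\<exists>l\<in>{l \<in> L. p \<in> l}. z = ?f l"
      using foot_eq[of l z] z by auto
  qed
  then show ?thesis
    using card_lines_through[OF assms(1)] bij_betw_same_card by fastforce
qed

theorem strongly_regular_point_graph:
  assumes "finite P"
  shows "strongly_regular_graph (point_graph P L) (card P) ((t + 1) * s) (s - 1) (t + 1)"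
proof -
  interpret pair_graph "point_graph P L"
    using assms by (rule pair_graph_point_graph)
  have common: "neighbours (point_graph P L) x \<inter> neighbours (point_graph P L) y
      = {z \<in> P. collinear L x z \<and> collinear L y z}" if "x \<in> P" "y \<in> P" for x y
    using that by (auto simp: neighbours_point_graph)
  show ?thesis
  proof
    fix x assume "x \<in> pverts (point_graph P L)"
    then show "card (neighbours (point_graph P L) x) = (t + 1) * s"
      using card_collinear by (simp add: neighbours_point_graph)
  qed (simp_all add: common card_common_collinear card_common_noncollinear)
qed

section \<open>Connectedness of the complement\<close>

text \<open>Choose a third point \<open>r\<close> on the line \<open>l\<close> through
  \<open>p\<close> and \<open>q\<close> (from \<open>s \<ge> 2\<close>), a second line
  \<open>m\<close> through \<open>r\<close> (from \<open>t \<ge> 1\<close>), and \<open>z\<close> on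
  \<open>m\<close> other than \<open>r\<close>. Then \<open>z\<close> is off \<open>l\<close>, and
  \<open>r\<close> is the only point of \<open>l\<close> collinear with it. So \<open>z\<close> is a
  common neighbour of \<open>p\<close> and \<open>q\<close> in the complement.\<close>

lemma obtains_common_noncollinear:
  assumes "s \<ge> 2" "t \<ge> 1" "p \<in> P" "q \<in> P" "collinear L p q"
  obtains z where "z \<in> P" "z \<noteq> p" "z \<noteq> q" "\<not> collinear L z p" "\<not> collinear L z q"
proof -
  obtain l where l: "l \<in> L" "p \<in> l" "q \<in> l" "p \<noteq> q"
    using assms by (auto simp: collinear_def)
  have "\<not> l \<subseteq> {p, q}"
    using card_mono[of "{p, q}" l] card_line[OF l(1)] assms(1) l(4) by auto
  then obtain r where r: "r \<in> l" "r \<noteq> p" "r \<noteq> q" by auto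
  have "\<not> {m \<in> L. r \<in> m} \<subseteq> {l}"
    using card_mono[of "{l}" "{m \<in> L. r \<in> m}"] card_lines_through[OF line_points[OF l(1) r(1)]]
      assms(2) by auto
  then obtain m where m: "m \<in> L" "r \<in> m" "m \<noteq> l" by auto
  have "\<not> m \<subseteq> {r}"
    using card_mono[of "{r}" m] card_line[OF m(1)] assms(1) by auto
  then obtain z where z: "z \<in> m" "z \<noteq> r" by auto
  have "z \<in> P" "r \<in> P"
    using z(1) r(1) l(1) m(1) line_points by auto
  then have "z \<notin> l"
    using unique_line[of z r l m] z r m l by blast
  moreover have "collinear L z r"
    using m z collinearI by blast
  ultimately have "\<not> collinear L z p" "\<not> collinear L z q"
    using collinear_with_two_on_line[OF \<open>z \<in> P\<close> l(1) r(1)] l r by metis+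
  then show thesis
    using that \<open>z \<in> P\<close> \<open>z \<notin> l\<close> l by metis
qed

lemma connected_complement_point_graph:
  assumes "finite P" "P \<noteq> {}" "s \<ge> 2" "t \<ge> 1"
  shows "connected (with_proj (graph_complement (point_graph P L)))"
proof -
  let ?C = "graph_complement (point_graph P L)"
  interpret C: pair_graph ?C
    using assms(1) by (intro pair_graph_graph_complement pair_graph_point_graph)
  \<comment> \<open>Equal points count as non-collinear, so the case \<open>u = w\<close> is
    included through the empty path.\<close>
  have adj: "u \<rightarrow>\<^sup>*\<^bsub>with_proj ?C\<^esub> w" if "u \<in> P" "w \<in> P" "\<not> collinear L u w" for u w
    using that C.reachable_refl[of u] C.reachable_adjI[of u w] by (cases "u = w") auto
  have "u \<rightarrow>\<^sup>*\<^bsub>with_proj ?C\<^esub> w" if uw: "u \<in> P" "w \<in> P" for u w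
  proof (cases "collinear L u w")
    case True
    then obtain z where z: "z \<in> P" "\<not> collinear L z u" "\<not> collinear L z w"
      using obtains_common_noncollinear assms uw by metis
    then have "\<not> collinear L u z"
      using collinear_sym by metis
    then show ?thesis
      using z uw adj C.reachable_trans by blast
  qed (use uw adj in blast)
  then have "strongly_connected (with_proj ?C)"
    using assms(2) by (intro strongly_connectedI) auto
  then show ?thesis
    \<comment> \<open>The library's \<open>connected\<close> refers to the symmetrized graph, hence
      the transfer of reachability.\<close>
    unfolding connected_def strongly_connected_def
    using C.reachable_mk_symmetricI by simp
qed

end

section \<open>Disconnection and component sizes after removing vertices\<close>

lemma remove_vertices_simps [simp]:
  "verts (remove_vertices G S) = pverts G - S"
  "arcs (remove_vertices G S) = {e \<in> parcs G. fst e \<notin> S \<and> snd e \<notin> S \<and> fst e \<in> pverts G \<and> snd e \<in> pverts G}"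
  "tail (remove_vertices G S) = fst"
  "head (remove_vertices G S) = snd"
  by (auto simp: remove_vertices_def)

lemma dominates_remove_vertices:
  "u \<rightarrow>\<^bsub>remove_vertices G S\<^esub> w \<longleftrightarrow> (u, w) \<in> parcs G \<and> u \<in> pverts G - S \<and> w \<in> pverts G - S"
  by (auto simp: arcs_ends_conv image_iff)

text \<open>Membership in \<open>A\<close> is preserved along every arc, hence along every walk of
  the symmetrized graph, so no walk leads from \<open>A\<close> to \<open>B\<close>.\<close>

lemma not_connected_if_no_arcs_between:
  assumes "A \<noteq> {}" "B \<noteq> {}" "A \<inter> B = {}" "verts G = A \<union> B"
    and "\<And>e. e \<in> arcs G \<Longrightarrow> tail G e \<in> A \<longleftrightarrow> head G e \<in> A"
  shows "\<not> connected G"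
proof
  assume conn: "connected G"
  have step: "u \<in> A \<longleftrightarrow> w \<in> A" if "(u, w) \<in> parcs (mk_symmetric G)" for u w
    using that assms(5) by (auto simp: parcs_mk_symmetric)
  have stays: "w \<in> A" if "(u, w) \<in> rtrancl_on X (parcs (mk_symmetric G))" "u \<in> A" for u w X
    using that by induct (use step in auto)
  obtain a b where ab: "a \<in> A" "b \<in> B"
    using assms by auto
  then have "(a, b) \<in> rtrancl_on (verts G) (parcs (mk_symmetric G))"
    using conn assms(4) by (auto simp: connected_def strongly_connected_def reachable_def)
  then show False
    using stays ab assms(3) by blast
qed

text \<open>A vertex and any remaining neighbour reach each other through the two orientations of
  their edge, so they share a strongly connected component.\<close>

lemma card_scc_ge_2:
  assumes "pair_graph G" "C \<in> pre_digraph.sccs_verts (remove_vertices G S)"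
    and nbr: "\<And>u. u \<in> pverts G - S \<Longrightarrow> \<exists>w \<in> pverts G - S. (u, w) \<in> parcs G"
  shows "card C \<ge> 2"
proof -
  interpret pair_graph G by fact
  interpret R: wf_digraph "remove_vertices G S"
    by unfold_locales auto
  note scc = assms(2)[unfolded R.in_sccs_verts_conv_reachable]
  \<comment> \<open>An infinite set has \<open>card\<close> 0, so the lower bound requires
    finiteness.\<close>
  have fin: "finite C"
  proof (rule finite_subset)
    show "C \<subseteq> pverts G"
      using scc R.reachable_in_verts by fastforce
  qed (rule pair_finite_verts)
  obtain u where u: "u \<in> C" using scc by auto
  then have "u \<in> pverts G - S"
    using scc R.reachable_in_verts by fastforce
  then obtain w where w: "w \<in> pverts G - S" "(u, w) \<in> parcs G"
    using nbr by blast
  have "(w, u) \<in> parcs G"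
    using w pair_sym_arcs by (auto simp: symmetric_def sym_def)
  then have "u \<rightarrow>\<^bsub>remove_vertices G S\<^esub> w" "w \<rightarrow>\<^bsub>remove_vertices G S\<^esub> u"
    using w \<open>u \<in> pverts G - S\<close> by (auto simp: dominates_remove_vertices)
  then have "w \<in> C"
    using scc u R.reachable_adjI by blast
  moreover have "u \<noteq> w"
    using w pair_no_loops by fastforce
  ultimately show ?thesis
    using u fin card_mono[of C "{u, w}"] by auto
qed

section \<open>The two cocliques of a regular pair\<close>

lemma (in generalized_quadrangle) regular_pair_bicoclique:
  assumes "t \<ge> 2" and reg: "regular_pair (point_graph P L) t x y"
  obtains A B where "A \<subseteq> P" "B \<subseteq> P" "A \<inter> B = {}" "card A = t + 1" "card B = t + 1"
    "\<And>a a'. a \<in> A \<Longrightarrow> a' \<in> A \<Longrightarrow> \<not> collinear L a a'"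
    "\<And>b b'. b \<in> B \<Longrightarrow> b' \<in> B \<Longrightarrow> \<not> collinear L b b'"
    "\<And>a b. a \<in> A \<Longrightarrow> b \<in> B \<Longrightarrow> collinear L a b"
proof -
  have xy: "x \<in> P" "y \<in> P" "x \<noteq> y" "\<not> collinear L x y"
    using reg by (auto simp: regular_pair_def)
  define A where "A = perp (point_graph P L) {x, y}"
  define B where "B = perp (point_graph P L) A"
  \<comment> \<open>Since \<open>x\<close> and \<open>y\<close> are not collinear, neither lies in
    the other's perp, so the closed neighbourhoods in \<open>perp\<close> may be replaced by open
    ones.\<close>
  have A_eq: "A = {z \<in> P. collinear L x z \<and> collinear L y z}"
    using xy collinear_sym[of L y x] by (auto simp: A_def perp_def neighbours_point_graph)
  have cardA: "card A = t + 1"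
    unfolding A_eq using card_common_noncollinear xy by blast
  have cardB: "card B = t + 1"
    using reg by (simp add: regular_pair_def A_def B_def)
  have cocliqueA: "\<not> collinear L a a'" if "a \<in> A" "a' \<in> A" for a a'
    using that collinear_if_common_neighbours[OF xy(1-3), of a a'] xy(4) by (auto simp: A_eq)
  have B_cases: "b = a \<or> collinear L a b" if "a \<in> A" "b \<in> B" for a b
    using that by (auto simp: B_def perp_def neighbours_point_graph)
  \<comment> \<open>A point in both \<open>A\<close> and \<open>B\<close> would be collinear with
    every other point of \<open>A\<close>. As such a point exists, this contradicts
    \<open>cocliqueA\<close>.\<close>
  have "\<exists>a'\<in>A. a' \<noteq> a" for a
  proof -
    have "\<not> A \<subseteq> {a}"
      using card_mono[of "{a}" A] cardA assms(1) by auto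
    then show ?thesis by auto
  qed
  then have disjoint: "A \<inter> B = {}"
    using B_cases cocliqueA by blast
  then have AB: "collinear L a b" if "a \<in> A" "b \<in> B" for a b
    using that B_cases by blast
  \<comment> \<open>Two distinct points of \<open>A\<close> are common neighbours of all points of
    \<open>B\<close>, so a collinear pair in \<open>B\<close> would make them collinear.\<close>
  obtain a a' where a: "a \<in> A" "a' \<in> A" "a \<noteq> a'"
    using \<open>\<And>a. \<exists>a'\<in>A. a' \<noteq> a\<close> by metis
  have "A \<subseteq> P" "B \<subseteq> P"
    by (auto simp: A_def B_def perp_def)
  then have cocliqueB: "\<not> collinear L b b'" if "b \<in> B" "b' \<in> B" for b b'
    using that collinear_if_common_neighbours[of a a' b b'] a AB cocliqueA by blast
  show thesis
    by (rule that[OF \<open>A \<subseteq> P\<close> \<open>B \<subseteq> P\<close> disjoint cardA cardB cocliqueA cocliqueB AB])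
qed

theorem mainTheorem8:
  fixes P :: "'a set" and L :: "'a set set" and s t :: nat
  assumes "s \<ge> 2" and "t \<ge> 2"
    and "finite P"
    and "generalized_quadrangle P L s t"
    and "\<exists>x y. regular_pair (point_graph P L) t x y"
  shows "connected (with_proj (graph_complement (point_graph P L))) \<and>
    (\<exists>v k l m. strongly_regular_graph (graph_complement (point_graph P L)) v k l m) \<and>
    (\<forall>v k l m. strongly_regular_graph (graph_complement (point_graph P L)) v k l m \<longrightarrow>
      (\<exists>S. disconnecting_set (graph_complement (point_graph P L)) S \<and>
        (\<forall>C \<in> pre_digraph.sccs_verts (remove_vertices (graph_complement (point_graph P L)) S).
          card C \<ge> 2) \<and>
        int (card S) < 2 * int k - int l - 2))"
proof -
  interpret generalized_quadrangle P L s t by fact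
  obtain x y where xy: "regular_pair (point_graph P L) t x y"
    using assms(5) by blast
  let ?C = "graph_complement (point_graph P L)"
  interpret \<Gamma>: strongly_regular_graph "point_graph P L" "card P" "(t + 1) * s" "s - 1" "t + 1"
    using assms(3) by (rule strongly_regular_point_graph)
  have x: "x \<in> P" "y \<in> P" "x \<noteq> y" "\<not> collinear L x y"
    using xy by (auto simp: regular_pair_def)
  have graphC: "pair_graph ?C"
    using \<Gamma>.pair_graph_axioms by (rule pair_graph_graph_complement)
  have main: "\<exists>S. disconnecting_set ?C S \<and>
      (\<forall>C \<in> pre_digraph.sccs_verts (remove_vertices ?C S). card C \<ge> 2) \<and>
      int (card S) < 2 * int k - int l - 2"
    if srg: "strongly_regular_graph ?C v k l m" for v k l m
  proof -
    interpret C: strongly_regular_graph ?C v k l m by fact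
    \<comment> \<open>The given parameters are arbitrary; counting at \<open>x\<close>, and at the
      pair \<open>x\<close>, \<open>y\<close>, which is adjacent in the complement, determines
      \<open>k\<close> and \<open>l\<close>.\<close>
    have k: "k + (t + 1) * s + 1 = card P"
      using \<Gamma>.card_neighbours_complement[of x] C.regular[of x] x by simp
    have l: "l + 2 * ((t + 1) * s) + 2 = card P + (t + 1)"
      using \<Gamma>.card_common_neighbours_complement_nonadjacent[of x y]
        C.common_neighbours_adjacent[of x y] x by simp
    obtain A B where AB: "A \<subseteq> P" "B \<subseteq> P" "A \<inter> B = {}" "card A = t + 1" "card B = t + 1"
      and A: "\<And>a a'. a \<in> A \<Longrightarrow> a' \<in> A \<Longrightarrow> \<not> collinear L a a'"
      and B: "\<And>b b'. b \<in> B \<Longrightarrow> b' \<in> B \<Longrightarrow> \<not> collinear L b b'"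
      and join: "\<And>a b. a \<in> A \<Longrightarrow> b \<in> B \<Longrightarrow> collinear L a b"
      using regular_pair_bicoclique[OF assms(2) xy] by blast
    define S where "S = P - (A \<union> B)"
    have rest: "pverts ?C - S = A \<union> B"
      using AB by (auto simp: S_def)
    have join': "collinear L b a" if "a \<in> A" "b \<in> B" for a b
      using join that collinear_sym by metis
    have ne: "A \<noteq> {}" "B \<noteq> {}"
      using AB by auto
    have "\<not> connected (remove_vertices ?C S)"
    proof (rule not_connected_if_no_arcs_between[OF ne AB(3)])
      show "verts (remove_vertices ?C S) = A \<union> B"
        using rest by simp
      fix e assume "e \<in> arcs (remove_vertices ?C S)"
      then have "\<not> collinear L (fst e) (snd e)" "fst e \<in> A \<union> B" "snd e \<in> A \<union> B"
        using rest graph_complement_simps(2)[of "fst e" "snd e" "point_graph P L"]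
          point_graph_simps(2)[of "fst e" "snd e" P L] by (auto simp del: point_graph_simps(2))
      then show "tail (remove_vertices ?C S) e \<in> A \<longleftrightarrow> head (remove_vertices ?C S) e \<in> A"
        using join join' by auto
    qed
    then have disc: "disconnecting_set ?C S"
      using rest ne by (auto simp: disconnecting_set_def S_def)
    \<comment> \<open>\<open>A\<close> and \<open>B\<close> are cliques of the complement with more
      than one vertex, so no remaining vertex is isolated.\<close>
    have nbr: "\<exists>w \<in> pverts ?C - S. (u, w) \<in> parcs ?C" if u: "u \<in> pverts ?C - S" for u
    proof -
      obtain D where D: "D = A \<or> D = B" "u \<in> D"
        using u rest by blast
      then have "\<not> D \<subseteq> {u}"
        using card_mono[of "{u}" D] AB(4,5) assms(2) by auto
      then obtain w where "w \<in> D" "w \<noteq> u" by auto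
      then show ?thesis
        using D A B AB(1,2) unfolding rest by auto
    qed
    have comps: "\<forall>C \<in> pre_digraph.sccs_verts (remove_vertices ?C S). card C \<ge> 2"
      using card_scc_ge_2[OF graphC _ nbr] by blast
    have fin: "finite A" "finite B"
      using AB assms(3) finite_subset by auto
    have "card (A \<union> B) = 2 * (t + 1)"
      using AB fin by (simp add: card_Un_disjoint)
    \<comment> \<open>The inequality makes the subtraction on \<open>nat\<close> exact, so that it
      carries over to \<open>int\<close>.\<close>
    moreover have "card S = card P - card (A \<union> B)" "card (A \<union> B) \<le> card P"
      unfolding S_def using AB fin assms(3) by (auto intro!: card_Diff_subset card_mono)
    ultimately have "int (card S) = int (card P) - 2 * int t - 2"
      by simp
    \<comment> \<open>The two sides differ by \<open>t - 1\<close>, which is positive because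
      \<open>t \<ge> 2\<close>.\<close>
    also have "\<dots> < int (card P) - int t - 3"
      using assms(2) by simp
    also have "\<dots> = 2 * int k - int l - 2"
      using k l by linarith
    finally show ?thesis
      using disc comps by blast
  qed
  have "connected (with_proj ?C)"
    using connected_complement_point_graph assms(1-3) x(1) by fastforce
  then show ?thesis
    using \<Gamma>.strongly_regular_graph_complement main by blast
qed

end
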